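(* Let $k$ be a positive integer and let $n$ be a composite positive integer. Then $n$ is a $k$-strong Giuga number if and only if $n$ is both a Giuga number and a $k$-Carmichael number.
   Context: $\lambda$ denotes the Carmichael function: $\lambda(n)$ is the exponent of the group $(\mathbb{Z}/n\mathbb{Z})^\times$. $\mathbb{N}$ denotes the positive integers. A Giuga number is a composite positive integer $n$ such that $p \mid (n/p - 1)$ for every prime divisor $p$ of $n$. For $k\in\mathbb{N}$, a positive integer $n$ is a $k$-Carmichael number if $\lambda(n)$ divides $k(n-1)$. For $k\in\mathbb{N}$, a composite positive integer $n$ is a $k$-strong Giuga number if $\sum_{j=1}^{n-1} j^{k(n-1)} \equiv -1 \pmod n$. *)

theory Defs
  imports "HOL-Number_Theory.Number_Theory"
begin

text \<open>
  \<^const>\<open>Carmichael\<close> is the library's Carmichael function, the least common multiple of the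
  multiplicative orders of the units modulo \<open>n\<close>. The following says that it is the exponent
  of the group of units, i.e. the (divisibility-)least exponent that kills every unit.
\<close>

lemma Carmichael_dvd_iff:
  fixes n m :: nat
  assumes "n > 0"
  shows "Carmichael n dvd m \<longleftrightarrow> (\<forall>x::nat. coprime n x \<longrightarrow> [x ^ m = 1] (mod n))"
proof
  assume "Carmichael n dvd m"
  then show "\<forall>x::nat. coprime n x \<longrightarrow> [x ^ m = 1] (mod n)"
    using Carmichael_divides ord_divides dvd_trans by blast
next
  assume *: "\<forall>x::nat. coprime n x \<longrightarrow> [x ^ m = 1] (mod n)"
  show "Carmichael n dvd m"
    unfolding Carmichael_def
  proof (rule Lcm_least)
    fix d assume "d \<in> ord n ` totatives n"
    then obtain a where "a \<in> totatives n" "d = ord n a" by blast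
    then show "d dvd m"
      using * ord_divides by (auto simp: totatives_def coprime_commute)
  qed
qed

definition composite :: "nat \<Rightarrow> bool" where
  "composite n \<longleftrightarrow> n > 1 \<and> \<not> prime n"

definition giuga_number :: "nat \<Rightarrow> bool" where
  "giuga_number n \<longleftrightarrow>
     composite n \<and> (\<forall>p. prime p \<and> p dvd n \<longrightarrow> int p dvd int (n div p) - 1)"

definition k_carmichael_number :: "nat \<Rightarrow> nat \<Rightarrow> bool" where
  "k_carmichael_number k n \<longleftrightarrow> n > 0 \<and> Carmichael n dvd k * (n - 1)"

definition k_strong_giuga_number :: "nat \<Rightarrow> nat \<Rightarrow> bool" where
  "k_strong_giuga_number k n \<longleftrightarrow>
     composite n \<and> [(\<Sum>j = 1..n - 1. int j ^ (k * (n - 1))) = - 1] (mod int n)"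

end

theory Submission
  imports Defs "HOL-Computational_Algebra.Squarefree"
begin

text \<open>
  Split the residues below \<open>n\<close> into \<open>n div p\<close> blocks of length \<open>p\<close>. The \<open>m\<close>-th powers in one
  block sum to \<open>-1\<close> modulo \<open>p\<close> if \<open>p - 1\<close> divides \<open>m\<close>, and to \<open>0\<close> otherwise. So the power sum is
  \<open>-1\<close> modulo \<open>p\<close> iff \<open>p - 1\<close> divides \<open>m\<close> and \<open>n div p\<close> is \<open>1\<close> modulo \<open>p\<close>. The last condition
  forces \<open>n\<close> to be squarefree, and for squarefree \<open>n\<close> both the congruence modulo \<open>n\<close> and the
  divisibility by \<open>\<lambda>(n)\<close>, which is then the least common multiple of the \<open>p - 1\<close>, can be
  checked one prime at a time.
\<close>

lemma squarefree_eq_prod_prime_factors: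
  fixes n :: nat
  assumes "squarefree n"
  shows "n = \<Prod>(prime_factors n)"
proof -
  have n: "n \<noteq> 0" using assms by (metis not_squarefree_0)
  have "n = (\<Prod>p\<in>prime_factors n. p ^ multiplicity p n)"
    using n prime_factorization_nat by blast
  also have "\<dots> = \<Prod>(prime_factors n)"
    using assms squarefree_factorial_semiring'[OF n] by (intro prod.cong) auto
  finally show ?thesis .
qed

text \<open>Chinese remainder theorem: a squarefree \<open>n\<close> is the product of its distinct,
  hence pairwise coprime, prime factors.\<close>

lemma squarefree_cong_iff:
  fixes n :: nat and x y :: int
  assumes "squarefree n"
  shows "[x = y] (mod int n) \<longleftrightarrow> (\<forall>p\<in>prime_factors n. [x = y] (mod int p))"
proof
  assume "[x = y] (mod int n)"
  then show "\<forall>p\<in>prime_factors n. [x = y] (mod int p)"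
    by (auto intro: cong_dvd_modulus simp: in_prime_factors_iff)
next
  assume *: "\<forall>p\<in>prime_factors n. [x = y] (mod int p)"
  have "[x = y] (mod (\<Prod>p\<in>prime_factors n. int p))"
    using * by (intro cong_cong_prod_coprime) (auto intro!: primes_coprime)
  also have "(\<Prod>p\<in>prime_factors n. int p) = int (\<Prod>(prime_factors n))"
    by simp
  finally show "[x = y] (mod int n)"
    using squarefree_eq_prod_prime_factors[OF assms] by simp
qed

lemma squarefree_Carmichael_dvd_iff:
  fixes n m :: nat
  assumes "squarefree n"
  shows "Carmichael n dvd m \<longleftrightarrow> (\<forall>p\<in>prime_factors n. p - 1 dvd m)"
proof -
  have "Carmichael n = Carmichael (\<Prod>p\<in>prime_factors n. p)"
    using squarefree_eq_prod_prime_factors[OF assms] by simp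
  also have "\<dots> = (LCM p\<in>prime_factors n. Carmichael p)"
    by (intro Carmichael_prod_coprime) (auto intro!: primes_coprime)
  also have "\<dots> = (LCM p\<in>prime_factors n. p - 1)"
    by (intro arg_cong[of _ _ Lcm] image_cong) (auto simp: Carmichael_prime in_prime_factors_iff)
  finally show ?thesis
    by (auto simp: Lcm_dvd_iff)
qed

text \<open>By Fermat each of the \<open>p - 1\<close> nonzero residues contributes 1, while
  \<open>j = 0\<close> contributes 0 because \<open>m > 0\<close>.\<close>

lemma power_sum_prime_eq_minus_1:
  fixes p m :: nat
  assumes p: "prime p" and m: "m > 0" "p - 1 dvd m"
  shows "[(\<Sum>j<p. int j ^ m) = - 1] (mod int p)"
proof -
  have "(\<Sum>j<p. int j ^ m) = (\<Sum>j=1..<p. int j ^ m)"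
    using m by (intro sum.mono_neutral_right) (auto simp: not_less_eq_eq)
  also have "[\<dots> = (\<Sum>j=1..<p. 1)] (mod int p)"
  proof (rule cong_sum)
    fix j assume "j \<in> {1..<p}"
    then have "coprime p j"
      using p by (intro prime_imp_coprime) (auto dest: dvd_imp_le)
    then have "[j ^ m = 1] (mod p)"
      using m p by (intro Carmichael_divides) (simp_all add: Carmichael_prime)
    then show "[int j ^ m = 1] (mod int p)"
      by (simp flip: cong_int_iff)
  qed
  also have "(\<Sum>j=1..<p. 1) = int p - 1"
    using prime_gt_0_nat[OF p] by (simp add: of_nat_diff)
  also have "[\<dots> = - 1] (mod int p)"
    by (simp add: cong_iff_dvd_diff)
  finally show ?thesis .
qed

text \<open>Multiplication by a unit \<open>g\<close> permutes the nonzero residues, so the sum is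
  unchanged modulo \<open>p\<close> by the factor \<open>g ^ m\<close>. If that factor is not 1, the
  sum must vanish.\<close>

lemma power_sum_prime_eq_0:
  fixes p m :: nat
  assumes p: "prime p" and m: "m > 0" "\<not> p - 1 dvd m"
  shows "[(\<Sum>j<p. int j ^ m) = 0] (mod int p)"
proof -
  \<comment> \<open>The index set consists of integers to match
    \<open>bij_betw_int_remainders_mult\<close>, which supplies the permutation.\<close>
  define S where "S = (\<Sum>j\<in>{1..<int p}. j ^ m)"
  \<comment> \<open>Such a \<open>g\<close> exists because the exponent of the unit group modulo
    \<open>p\<close> is \<open>p - 1\<close>, which does not divide \<open>m\<close>.\<close>
  obtain g :: nat where g: "coprime p g" "\<not> [g ^ m = 1] (mod p)"
    using m p Carmichael_dvd_iff[of p m] by (auto simp: Carmichael_prime prime_gt_0_nat)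
  have "int g ^ m * S = (\<Sum>j\<in>{1..<int p}. (int g * j) ^ m)"
    by (simp add: S_def sum_distrib_left power_mult_distrib)
  also have "[\<dots> = (\<Sum>j\<in>{1..<int p}. (int g * j mod int p) ^ m)] (mod int p)"
    by (intro cong_sum cong_pow) (simp add: cong_def)
  also have "(\<Sum>j\<in>{1..<int p}. (int g * j mod int p) ^ m) = S"
    unfolding S_def using g(1)
    by (intro sum.reindex_bij_betw bij_betw_int_remainders_mult) (simp add: coprime_commute)
  finally have "int p dvd (int g ^ m - 1) * S"
    by (simp add: cong_iff_dvd_diff algebra_simps)
  moreover have "\<not> int p dvd int g ^ m - 1"
    using g(2) by (metis cong_iff_dvd_diff cong_int_iff of_nat_1 of_nat_power)
  ultimately have "int p dvd S"
    using p prime_dvd_mult_iff[of "int p"] by (auto simp: prime_int_nat_transfer)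
  also have "S = (\<Sum>j=1..<p. int j ^ m)"
    unfolding S_def
    by (rule sum.reindex_bij_witness[of _ int nat]) auto
  also have "\<dots> = (\<Sum>j<p. int j ^ m)"
    using m by (intro sum.mono_neutral_left) (auto simp: not_less_eq_eq)
  finally show ?thesis
    by (simp add: cong_0_iff)
qed

text \<open>Block \<open>i\<close> is the range below \<open>p\<close> shifted by
  \<open>i * p\<close>, a multiple of \<open>p\<close>.\<close>

lemma power_sum_cong_blocks:
  fixes p n m :: nat
  assumes "p dvd n"
  shows "[(\<Sum>j<n. int j ^ m) = int (n div p) * (\<Sum>j<p. int j ^ m)] (mod int p)"
proof -
  have "(\<Sum>j<n. int j ^ m) = (\<Sum>i<n div p. \<Sum>j=i*p..<i*p+p. int j ^ m)"
    using assms by (simp add: sum.nat_group)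
  also have "[\<dots> = (\<Sum>i<n div p. \<Sum>j<p. int j ^ m)] (mod int p)"
  proof (rule cong_sum)
    fix i
    have "(\<Sum>j=i*p..<i*p+p. int j ^ m) = (\<Sum>j<p. int (i * p + j) ^ m)"
      by (rule sum.reindex_bij_witness[of _ "\<lambda>j. i * p + j" "\<lambda>j. j - i * p"]) auto
    also have "[\<dots> = (\<Sum>j<p. int j ^ m)] (mod int p)"
      by (intro cong_sum cong_pow) (simp add: cong_def)
    finally show "[(\<Sum>j=i*p..<i*p+p. int j ^ m) = (\<Sum>j<p. int j ^ m)] (mod int p)" .
  qed
  finally show ?thesis by simp
qed

lemma power_sum_cong_minus_1_iff:
  fixes p n m :: nat
  assumes p: "prime p" "p dvd n" and m: "m > 0"
  shows "[(\<Sum>j<n. int j ^ m) = - 1] (mod int p) \<longleftrightarrow>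
           p - 1 dvd m \<and> int p dvd int (n div p) - 1"
proof (cases "p - 1 dvd m")
  case True
  have "[(\<Sum>j<n. int j ^ m) = int (n div p) * - 1] (mod int p)"
    by (rule cong_trans[OF power_sum_cong_blocks[OF p(2)]
          cong_scalar_left[OF power_sum_prime_eq_minus_1[OF p(1) m True]]])
  then have "[(\<Sum>j<n. int j ^ m) = - 1] (mod int p) \<longleftrightarrow>
               [- int (n div p) = - 1] (mod int p)"
    by (simp add: cong_def)
  also have "\<dots> \<longleftrightarrow> [int (n div p) = 1] (mod int p)"
    by (rule cong_minus_minus_iff)
  finally show ?thesis
    using True by (simp add: cong_iff_dvd_diff)
next
  case False
  have "[(\<Sum>j<n. int j ^ m) = int (n div p) * 0] (mod int p)"
    by (rule cong_trans[OF power_sum_cong_blocks[OF p(2)]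
          cong_scalar_left[OF power_sum_prime_eq_0[OF p(1) m False]]])
  \<comment> \<open>A sum that vanishes modulo \<open>p\<close> could be -1 only for
    \<open>p = 1\<close>.\<close>
  then have "[(\<Sum>j<n. int j ^ m) = - 1] (mod int p) \<longleftrightarrow> [0 = - 1] (mod int p)"
    by (simp add: cong_def)
  also have "\<dots> \<longleftrightarrow> p = 1"
    by (simp add: cong_iff_dvd_diff)
  finally show ?thesis
    using False p(1) by auto
qed

text \<open>If the square of \<open>p\<close> divided \<open>n\<close>, then \<open>p\<close> would
  divide both \<open>n div p\<close> and \<open>n div p - 1\<close>, hence 1.\<close>

lemma squarefree_if_div_cong_1:
  fixes n :: nat
  assumes n: "n > 0" and *: "\<And>p. p \<in> prime_factors n \<Longrightarrow> int p dvd int (n div p) - 1"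
  shows "squarefree n"
proof -
  have False if p: "prime p" "p ^ 2 dvd n" for p
  proof -
    have "p dvd n div p"
      using p n by (auto simp: power2_eq_square elim!: dvdE)
    moreover have "int p dvd int (n div p) - 1"
      using p n by (intro *) (auto simp: prime_factors_dvd power2_eq_square dest: dvd_mult_left)
    ultimately have "int p dvd 1"
      by (metis dvd_diff_right_iff int_dvd_int_iff)
    with p(1) show False by simp
  qed
  with n show ?thesis
    by (auto simp: squarefree_factorial_semiring)
qed

theorem theorem1:
  fixes k n :: nat
  assumes "k > 0" and "composite n"
  shows "k_strong_giuga_number k n \<longleftrightarrow> giuga_number n \<and> k_carmichael_number k n"
proof -
  define m where "m = k * (n - 1)"
  define S where "S = (\<Sum>j<n. int j ^ m)"
  have n: "n > 1" and m: "m > 0"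
    using assms by (auto simp: composite_def m_def)
  \<comment> \<open>The term \<open>j = 0\<close> can be added since \<open>m > 0\<close> makes it
    0.\<close>
  have "(\<Sum>j = 1..n - 1. int j ^ m) = S"
    unfolding S_def using n m by (intro sum.mono_neutral_left) (auto simp: not_less_eq_eq)
  then have strong: "k_strong_giuga_number k n \<longleftrightarrow> [S = - 1] (mod int n)"
    using assms by (simp add: k_strong_giuga_number_def m_def)
  have giuga: "giuga_number n \<longleftrightarrow> (\<forall>p\<in>prime_factors n. int p dvd int (n div p) - 1)"
    using assms n by (auto simp: giuga_number_def prime_factors_dvd)
  have local_iff: "[S = - 1] (mod int p) \<longleftrightarrow> p - 1 dvd m \<and> int p dvd int (n div p) - 1"
    if "p \<in> prime_factors n" for p
    unfolding S_def using that m by (intro power_sum_cong_minus_1_iff) auto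
  \<comment> \<open>The Giuga property has to come first: it makes \<open>n\<close> squarefree,
    which the prime-by-prime comparison with \<open>Carmichael n\<close> below relies on.\<close>
  have strong_imp_giuga: "giuga_number n" if "[S = - 1] (mod int n)"
    unfolding giuga
  proof
    fix p assume p: "p \<in> prime_factors n"
    then have "[S = - 1] (mod int p)"
      using that by (auto intro: cong_dvd_modulus simp: in_prime_factors_iff)
    then show "int p dvd int (n div p) - 1"
      using local_iff[OF p] by simp
  qed
  have "[S = - 1] (mod int n) \<longleftrightarrow> Carmichael n dvd m" if "giuga_number n"
  proof -
    have "squarefree n"
      using that n by (intro squarefree_if_div_cong_1) (auto simp: giuga)
    then show ?thesis
      using that local_iff
      by (auto simp: squarefree_cong_iff squarefree_Carmichael_dvd_iff giuga)
  qed
  then show ?thesis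
    using strong strong_imp_giuga n by (auto simp: k_carmichael_number_def m_def)
qed

end
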